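(* Assume $\diamondsuit(S)$ for some stationary co-stationary set $S\subseteq\omega_1$. Let $T=K_{\omega_1}$ be the final compactum of a realisation of Talagrand's construction such that no two disjoint non-metrisable closed subspaces of $T$ are homeomorphic and $T$ does not have 2DCP. Then $T$ is not locally homogeneous, and $T$ is not h-homogeneous either.
   Context: For a stationary set $S\subseteq\omega_1$, $\diamondsuit(S)$ says: there are sets $D_\alpha\subseteq\alpha$ ($\alpha\in S$) such that for every $A\subseteq\omega_1$ the set $\{\alpha\in S: D_\alpha=A\cap\alpha\}$ is stationary. Co-stationary means that $\omega_1\setminus S$ is stationary. 2DCP: a Tychonoff space $X$ has the two-disjoint-copies property (2DCP) if there is a sequence $(K_n)_{n\in\omega}$ of non-empty compact subsets of $X$ such that each $K_n$ contains two disjoint subsets homeomorphic to $K_{n+1}$. A space $X$ is locally homogeneous if for all $x,y\in X$ there are open neighbourhoods $U$ of $x$ and $V$ of $y$ and a homeomorphism $\varphi:U\to V$ with $\varphi(x)=y$. A zero-dimensional space is h-homogeneous if each of its non-empty clopen subsets is homeomorphic to the whole space. Notation. $2^\alpha=\{0,1\}^\alpha$ has the product topology; for $\beta\le\alpha$, $\pi_{\beta,\alpha}$ is restriction of coordinates from $\alpha$ to $\beta$. For compact $K$, $M(K)=C(K)^*$ is the space of signed Radon measures with total variation norm; $\lambda^+$ is the positive part of $\lambda$; $f_*\lambda$ is the push-forward. A realisation of Talagrand's construction consists of the following data. (1) Compact spaces $K_\alpha\subseteq 2^\alpha$ ($\omega\le\alpha\le\omega_1$) with $K_\omega=2^\omega$;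 $K_{\alpha+1}=(Y_\alpha\times\{0\})\cup(Z_\alpha\times\{1\})$ with $Y_\alpha,Z_\alpha\subseteq K_\alpha$ closed and $Y_\alpha\cup Z_\alpha=K_\alpha$; and, for limit $\rho>\omega$, $K_\rho=\{t\in 2^\rho: t|_\beta\in K_\beta\text{ for all }\omega\le\beta<\rho\}$ (the inverse limit). The final compactum is $T=K_{\omega_1}$. (2) A scheduling map $\eta:[\omega,\omega_1)\to[\omega,\omega_1)\times\omega_1$ such that $\eta(\alpha)=(\theta,\delta)$ implies $\theta\le\alpha$ and $\delta\le\alpha$, and each pair $(\theta,\delta)\in[\omega,\omega_1)\times\omega_1$ equals $\eta(\alpha)$ for cofinally many $\alpha<\omega_1$ with $\alpha\ge\max\{\theta,\delta\}$. (3) For each $\beta\in[\omega,\omega_1)$, an enumeration $\big((U_n(\beta,\gamma))_{n\in\omega}\big)_{\gamma<\omega_1}$ of all sequences of pairwise disjoint non-empty clopen subsets of $K_\beta$. For $\theta\le\alpha$ and $\eta(\theta)=(\beta,\gamma)$ put $V_n(\theta,\alpha)=\pi_{\beta,\alpha}^{-1}(U_n(\beta,\gamma))\cap K_\alpha$. (4) For each $\theta\in[\omega,\omega_1)$, an enumeration $\big((\nu_n(\theta,\delta))_{n\in\omega}\big)_{\delta<\omega_1}$ of all admissible sequences in $M(K_\theta)$, i.e. those with $\|\nu_n\|=|\nu_n|(V_n(\theta,\theta))=1$ and $\|\nu_n^+\|\ge\frac12$ for all $n$. For $\theta\le\alpha$ put $B_n(\theta,\delta,\alpha)=\{\lambda\in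 M(K_\alpha):\|\lambda\|=1,\ (\pi_{\theta,\alpha})_*\lambda=\nu_n(\theta,\delta)\}$. (5) Sets $I(\theta,\alpha)$, $J(\theta,\delta,\alpha)$ (for $\omega\le\theta<\alpha<\omega_1$, $\delta<\alpha$) and $N_0(\theta,\delta),N_1(\theta,\delta)$, all subsets of $\omega$, such that: (A) $J(\theta,\delta,\alpha)\subseteq I(\theta,\alpha)$. (B) $N_0(\theta,\delta)\cap N_1(\theta,\delta)=\varnothing$. (C) $J(\theta,\delta,\alpha)\cap N_e(\theta,\delta)$ is infinite for $e=0,1$. (D) If $\alpha'\le\alpha$ and $\delta<\alpha'$, then $J(\theta,\delta,\alpha)\setminus J(\theta,\delta,\alpha')$ and $I(\theta,\alpha)\setminus I(\theta,\alpha')$ are finite whenever both sides are defined. (E) If $\omega\le\theta\le\alpha'<\alpha$, then for all sufficiently large $n\in I(\theta,\alpha)$: if $t,t'\in V_n(\theta,\alpha)$ and $\pi_{\theta,\alpha}(t)=\pi_{\theta,\alpha}(t')$, then $t(\alpha')=t'(\alpha')$. (F) For every choice $\lambda_n\in B_n(\theta,\delta,\alpha)$, the weak-star limit of $\lambda_n$ as $n\to\infty$ along $J(\theta,\delta,\alpha)$ exists. (G) If $\alpha=\alpha'+1$ and $\eta(\alpha')=(\theta,\delta)$, then for every choice $\lambda_n\in B_n(\theta,\delta,\alpha)$ both sets $\{n:\lambda_n(Z_{\alpha'}\times\{1\})\ge 1/6\}$ and $\{n:\lambda_n(Z_{\alpha'}\times\{1\})=0\}$ are infinite. *)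

theory Defs
  imports "HOL-Analysis.Analysis" "HOL-Library.Countable_Set_Type"
begin

section \<open>The ordinal \<open>\<omega>\<^sub>1\<close>\<close>

text \<open>The countable ordinals are the elements of the type \<open>omega1\<close>, the field of the cardinal
  successor of \<open>\<omega>\<close>. The ordinal \<open>\<omega>\<^sub>1\<close> itself is \<^term>\<open>UNIV\<close>, and an ordinal
  \<open>\<alpha> < \<omega>\<^sub>1\<close>, regarded as a set, is \<open>{..<\<alpha>}\<close>.\<close>

typedef omega1 = "Field (cardSuc natLeq)"
  using Field_cardSuc_not_empty[OF natLeq_Card_order] by auto

lemma cardSuc_natLeq_Well_order: "Well_order (cardSuc natLeq)"
  by (rule cardSuc_Well_order[OF natLeq_Card_order])

instantiation omega1 :: wellorder
begin

definition less_eq_omega1 :: "omega1 \<Rightarrow> omega1 \<Rightarrow> bool" where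
  "x \<le> y \<longleftrightarrow> (Rep_omega1 x, Rep_omega1 y) \<in> cardSuc natLeq"

definition less_omega1 :: "omega1 \<Rightarrow> omega1 \<Rightarrow> bool" where
  "(x :: omega1) < y \<longleftrightarrow> x \<le> y \<and> x \<noteq> y"

instance
proof
  have wo: "refl_on (Field (cardSuc natLeq)) (cardSuc natLeq)" "trans (cardSuc natLeq)"
    "antisym (cardSuc natLeq)" "total_on (Field (cardSuc natLeq)) (cardSuc natLeq)"
    "wf (cardSuc natLeq - Id)"
    using cardSuc_natLeq_Well_order
    by (auto simp: well_order_on_def linear_order_on_def partial_order_on_def preorder_on_def)
  show refl': "x \<le> x" for x :: omega1
    using refl_onD[OF wo(1) Rep_omega1] by (simp add: less_eq_omega1_def)
  show "x \<le> y \<Longrightarrow> y \<le> z \<Longrightarrow> x \<le> z" for x y z :: omega1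
    unfolding less_eq_omega1_def by (rule transD[OF wo(2)])
  show antisym': "x \<le> y \<Longrightarrow> y \<le> x \<Longrightarrow> x = y" for x y :: omega1
    unfolding less_eq_omega1_def by (metis Rep_omega1_inject antisymD[OF wo(3)])
  show "x < y \<longleftrightarrow> x \<le> y \<and> \<not> y \<le> x" for x y :: omega1
    using refl' antisym' unfolding less_omega1_def by blast
  show "x \<le> y \<or> y \<le> x" for x y :: omega1
  proof (cases "x = y")
    case False
    then have "Rep_omega1 x \<noteq> Rep_omega1 y"
      by (simp add: Rep_omega1_inject)
    then show ?thesis
      using wo(4) Rep_omega1[of x] Rep_omega1[of y] unfolding less_eq_omega1_def total_on_def
      by blast
  qed (simp add: refl')
  show "P a" if step: "\<And>x. (\<And>y. y < x \<Longrightarrow> P y) \<Longrightarrow> P x" for P and a :: omega1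
  proof -
    have "wf (inv_image (cardSuc natLeq - Id) Rep_omega1)"
      using wo(5) by (rule wf_inv_image)
    then show ?thesis
    proof (induction a rule: wf_induct_rule)
      case (less x)
      show ?case
      proof (rule step)
        fix y assume "y < x"
        then have "(y, x) \<in> inv_image (cardSuc natLeq - Id) Rep_omega1"
          by (simp add: less_omega1_def less_eq_omega1_def Rep_omega1_inject)
        then show "P y"
          by (rule less)
      qed
    qed
  qed
qed

end

lemma countable_lessThan_omega1:
  includes cardinal_syntax
  shows "countable {..<x :: omega1}"
proof -
  let ?r = "cardSuc natLeq" and ?x = "Rep_omega1 x"
  have "|underS ?r ?x| <o ?r"
    using card_of_underS[OF cardSuc_Card_order[OF natLeq_Card_order] Rep_omega1] .
  then have "|underS ?r ?x| \<le>o natLeq"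
    using cardSuc_ordLeq_ordLess[OF natLeq_Card_order card_of_Card_order] by blast
  then have "countable (underS ?r ?x)"
    by (simp add: countable_card_le_natLeq)
  moreover have "Rep_omega1 ` {..<x} \<subseteq> underS ?r ?x"
    by (auto simp: underS_def less_omega1_def less_eq_omega1_def Rep_omega1_inject)
  ultimately have "countable (Rep_omega1 ` {..<x})"
    by (rule countable_subset[rotated])
  then show ?thesis
    by (rule countable_image_inj_on) (simp add: inj_on_def Rep_omega1_inject)
qed

lemma uncountable_UNIV_omega1:
  includes cardinal_syntax
  shows "uncountable (UNIV :: omega1 set)"
proof
  assume "countable (UNIV :: omega1 set)"
  then have "countable (range Rep_omega1)"
    by (rule countable_image)
  then have "|Field (cardSuc natLeq)| \<le>o natLeq"
    by (simp add: type_definition.Rep_range[OF type_definition_omega1] countable_card_le_natLeq)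
  moreover have "natLeq <o |Field (cardSuc natLeq)|"
    by (rule ordLess_ordIso_trans[OF cardSuc_greater[OF natLeq_Card_order]
          ordIso_symmetric[OF card_of_Field_ordIso[OF cardSuc_Card_order[OF natLeq_Card_order]]]])
  ultimately show False
    using not_ordLess_ordLeq by blast
qed

definition osuc :: "omega1 \<Rightarrow> omega1" where
  "osuc \<alpha> = (LEAST \<beta>. \<alpha> < \<beta>)"

definition limit_ordinal :: "omega1 \<Rightarrow> bool" where
  "limit_ordinal \<rho> \<longleftrightarrow> (\<exists>\<beta>. \<beta> < \<rho>) \<and> (\<forall>\<beta><\<rho>. osuc \<beta> < \<rho>)"

definition omega :: omega1 where
  "omega = (LEAST \<rho>. limit_ordinal \<rho>)"

section \<open>Stationary sets and diamond\<close>

definition club :: "omega1 set \<Rightarrow> bool" where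
  "club C \<longleftrightarrow> (\<forall>\<alpha>. \<exists>\<gamma>\<in>C. \<alpha> < \<gamma>) \<and>
     (\<forall>\<rho>. limit_ordinal \<rho> \<and> (\<forall>\<beta><\<rho>. \<exists>\<gamma>\<in>C. \<beta> < \<gamma> \<and> \<gamma> < \<rho>) \<longrightarrow> \<rho> \<in> C)"

definition stationary :: "omega1 set \<Rightarrow> bool" where
  "stationary S \<longleftrightarrow> (\<forall>C. club C \<longrightarrow> S \<inter> C \<noteq> {})"

definition diamond :: "omega1 set \<Rightarrow> bool" where
  "diamond S \<longleftrightarrow> (\<exists>D :: omega1 \<Rightarrow> omega1 set.
     (\<forall>\<alpha>\<in>S. D \<alpha> \<subseteq> {..<\<alpha>}) \<and>
     (\<forall>A. stationary {\<alpha>\<in>S. D \<alpha> = A \<inter> {..<\<alpha>}}))"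

section \<open>Topological notions\<close>

definition has_2DCP :: "'a topology \<Rightarrow> bool" where
  "has_2DCP X \<longleftrightarrow> completely_regular_space X \<and> Hausdorff_space X \<and>
     (\<exists>K :: nat \<Rightarrow> 'a set. \<forall>n. K n \<noteq> {} \<and> compactin X (K n) \<and>
        (\<exists>A B. A \<subseteq> K n \<and> B \<subseteq> K n \<and> A \<inter> B = {} \<and>
           subtopology X A homeomorphic_space subtopology X (K (Suc n)) \<and>
           subtopology X B homeomorphic_space subtopology X (K (Suc n))))"

definition locally_homogeneous :: "'a topology \<Rightarrow> bool" where
  "locally_homogeneous X \<longleftrightarrow> (\<forall>x\<in>topspace X. \<forall>y\<in>topspace X. \<exists>U V \<phi>.
     openin X U \<and> x \<in> U \<and> openin X V \<and> y \<in> V \<and>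
     homeomorphic_map (subtopology X U) (subtopology X V) \<phi> \<and> \<phi> x = y)"

text \<open>\<open>X dim_le 0\<close> says that the clopen sets form a base of \<open>X\<close>.\<close>

definition h_homogeneous :: "'a topology \<Rightarrow> bool" where
  "h_homogeneous X \<longleftrightarrow> X dim_le 0 \<and>
     (\<forall>C. openin X C \<and> closedin X C \<and> C \<noteq> {} \<longrightarrow> subtopology X C homeomorphic_space X)"

section \<open>Signed Radon measures\<close>

text \<open>A signed measure on \<open>X\<close> is a real-valued set function on the Borel sets of \<open>X\<close>. It is
  extended by \<open>0\<close> to the other subsets, so that equality of measures is equality of functions.
  By the Riesz representation theorem, for compact Hausdorff \<open>X\<close> the set \<open>radon_measures X\<close> below
  is \<open>M(X) = C(X)*\<close>, with norm \<open>tv_norm X\<close>; \<open>pos_part X \<mu>\<close> and \<open>neg_part X \<mu>\<close> are the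
  components of the Jordan decomposition.\<close>

definition borel_sets :: "'a topology \<Rightarrow> 'a set set" where
  "borel_sets X = sigma_sets (topspace X) {U. openin X U}"

definition signed_measure :: "'a topology \<Rightarrow> ('a set \<Rightarrow> real) \<Rightarrow> bool" where
  "signed_measure X \<mu> \<longleftrightarrow> \<mu> {} = 0 \<and> (\<forall>B. B \<notin> borel_sets X \<longrightarrow> \<mu> B = 0) \<and>
     (\<forall>A :: nat \<Rightarrow> 'a set. range A \<subseteq> borel_sets X \<and> disjoint_family A \<longrightarrow>
        (\<lambda>n. \<mu> (A n)) sums \<mu> (\<Union>n. A n))"

definition variation :: "'a topology \<Rightarrow> ('a set \<Rightarrow> real) \<Rightarrow> 'a set \<Rightarrow> real" where
  "variation X \<mu> B = (if B \<in> borel_sets X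
     then Sup {\<Sum>A\<in>P. \<bar>\<mu> A\<bar> |P. finite P \<and> P \<subseteq> borel_sets X \<and> disjoint P \<and> \<Union>P = B}
     else 0)"

definition pos_part :: "'a topology \<Rightarrow> ('a set \<Rightarrow> real) \<Rightarrow> 'a set \<Rightarrow> real" where
  "pos_part X \<mu> B = (variation X \<mu> B + \<mu> B) / 2"

definition neg_part :: "'a topology \<Rightarrow> ('a set \<Rightarrow> real) \<Rightarrow> 'a set \<Rightarrow> real" where
  "neg_part X \<mu> B = (variation X \<mu> B - \<mu> B) / 2"

definition tv_norm :: "'a topology \<Rightarrow> ('a set \<Rightarrow> real) \<Rightarrow> real" where
  "tv_norm X \<mu> = variation X \<mu> (topspace X)"

definition radon_measures :: "'a topology \<Rightarrow> ('a set \<Rightarrow> real) set" where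
  "radon_measures X = {\<mu>. signed_measure X \<mu> \<and>
     (\<forall>B\<in>borel_sets X. \<forall>\<epsilon>>0. \<exists>C\<in>borel_sets X.
        C \<subseteq> B \<and> compactin X C \<and> variation X \<mu> (B - C) < \<epsilon>)}"

definition push_forward ::
    "'a topology \<Rightarrow> 'b topology \<Rightarrow> ('a \<Rightarrow> 'b) \<Rightarrow> ('a set \<Rightarrow> real) \<Rightarrow> 'b set \<Rightarrow> real" where
  "push_forward X Y f \<mu> B = (if B \<in> borel_sets Y then \<mu> (f -` B \<inter> topspace X) else 0)"

definition to_measure :: "'a topology \<Rightarrow> ('a set \<Rightarrow> real) \<Rightarrow> 'a measure" where
  "to_measure X \<mu> = measure_of (topspace X) {U. openin X U} (\<lambda>B. ennreal (\<mu> B))"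

definition signed_integral :: "'a topology \<Rightarrow> ('a set \<Rightarrow> real) \<Rightarrow> ('a \<Rightarrow> real) \<Rightarrow> real" where
  "signed_integral X \<mu> f =
     (\<integral>x. f x \<partial>to_measure X (pos_part X \<mu>)) - (\<integral>x. f x \<partial>to_measure X (neg_part X \<mu>))"

text \<open>Weak-star convergence in \<open>M(X) = C(X)*\<close> as \<open>n \<rightarrow> \<infinity>\<close> along the infinite index set \<open>J\<close>.\<close>

definition weak_star_limit_along ::
    "'a topology \<Rightarrow> nat set \<Rightarrow> (nat \<Rightarrow> 'a set \<Rightarrow> real) \<Rightarrow> ('a set \<Rightarrow> real) \<Rightarrow> bool" where
  "weak_star_limit_along X J \<mu> \<mu>' \<longleftrightarrow> \<mu>' \<in> radon_measures X \<and>
     (\<forall>f. continuous_map X euclideanreal f \<longrightarrow>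
        ((\<lambda>n. signed_integral X (\<mu> n) f) \<longlongrightarrow> signed_integral X \<mu>' f)
          (inf sequentially (principal J)))"

section \<open>Talagrand's construction\<close>

text \<open>For \<open>A = {..<\<alpha>}\<close> or \<open>A = UNIV\<close>, \<open>cube A\<close> is the space \<open>2\<^sup>\<alpha>\<close> or \<open>2\<close> to the power
  \<open>\<omega>\<^sub>1\<close>. Its points are the functions to \<^typ>\<open>bool\<close> that are \<^term>\<open>undefined\<close> outside \<open>A\<close>, so
  that the coordinate restriction to \<open>2\<^sup>\<beta>\<close> is \<open>\<lambda>t. restrict t {..<\<beta>}\<close>.\<close>

definition cube :: "omega1 set \<Rightarrow> (omega1 \<Rightarrow> bool) topology" where
  "cube A = product_topology (\<lambda>_. discrete_topology UNIV) A"

definition proj :: "omega1 \<Rightarrow> (omega1 \<Rightarrow> bool) \<Rightarrow> omega1 \<Rightarrow> bool" where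
  "proj \<beta> t = restrict t {..<\<beta>}"

definition inverse_limit ::
    "(omega1 \<Rightarrow> (omega1 \<Rightarrow> bool) set) \<Rightarrow> omega1 set \<Rightarrow> (omega1 \<Rightarrow> bool) set" where
  "inverse_limit K A = {t \<in> topspace (cube A). \<forall>\<beta>\<in>A. omega \<le> \<beta> \<longrightarrow> proj \<beta> t \<in> K \<beta>}"

definition space_at :: "(omega1 \<Rightarrow> (omega1 \<Rightarrow> bool) set) \<Rightarrow> omega1 \<Rightarrow> (omega1 \<Rightarrow> bool) topology"
  where "space_at K \<alpha> = subtopology (cube {..<\<alpha>}) (K \<alpha>)"

text \<open>The space at stage \<open>\<omega>\<^sub>1\<close>, which is a limit stage.\<close>

definition final_compactum :: "(omega1 \<Rightarrow> (omega1 \<Rightarrow> bool) set) \<Rightarrow> (omega1 \<Rightarrow> bool) topology"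
  where "final_compactum K = subtopology (cube UNIV) (inverse_limit K UNIV)"

text \<open>\<open>extend_by \<alpha> b A\<close> is \<open>A \<times> {b}\<close> as a subset of \<open>2\<close> to the power \<open>\<alpha> + 1\<close>,
  for \<open>A \<subseteq> 2\<^sup>\<alpha>\<close>.\<close>

definition extend_by :: "omega1 \<Rightarrow> bool \<Rightarrow> (omega1 \<Rightarrow> bool) set \<Rightarrow> (omega1 \<Rightarrow> bool) set" where
  "extend_by \<alpha> b A = (\<lambda>t. t(\<alpha> := b)) ` A"

definition disjoint_clopen_seqs :: "'a topology \<Rightarrow> (nat \<Rightarrow> 'a set) set" where
  "disjoint_clopen_seqs X = {U. disjoint_family U \<and>
     (\<forall>n. openin X (U n) \<and> closedin X (U n) \<and> U n \<noteq> {})}"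

definition admissible_seqs ::
    "'a topology \<Rightarrow> (nat \<Rightarrow> 'a set) \<Rightarrow> (nat \<Rightarrow> 'a set \<Rightarrow> real) set" where
  "admissible_seqs X V = {\<nu>. \<forall>n. \<nu> n \<in> radon_measures X \<and> tv_norm X (\<nu> n) = 1 \<and>
     variation X (\<nu> n) (V n) = 1 \<and> tv_norm X (pos_part X (\<nu> n)) \<ge> 1/2}"

locale talagrand_data =
  fixes K :: "omega1 \<Rightarrow> (omega1 \<Rightarrow> bool) set"
    and Y Z :: "omega1 \<Rightarrow> (omega1 \<Rightarrow> bool) set"
    and \<eta> :: "omega1 \<Rightarrow> omega1 \<times> omega1"
    and U :: "omega1 \<Rightarrow> omega1 \<Rightarrow> nat \<Rightarrow> (omega1 \<Rightarrow> bool) set"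
    and \<nu> :: "omega1 \<Rightarrow> omega1 \<Rightarrow> nat \<Rightarrow> (omega1 \<Rightarrow> bool) set \<Rightarrow> real"
    and I :: "omega1 \<Rightarrow> omega1 \<Rightarrow> nat set"
    and J :: "omega1 \<Rightarrow> omega1 \<Rightarrow> omega1 \<Rightarrow> nat set"
    and N0 N1 :: "omega1 \<Rightarrow> omega1 \<Rightarrow> nat set"
begin

definition V :: "omega1 \<Rightarrow> omega1 \<Rightarrow> nat \<Rightarrow> (omega1 \<Rightarrow> bool) set" where
  "V \<theta> \<alpha> n = (case \<eta> \<theta> of (\<beta>, \<gamma>) \<Rightarrow> proj \<beta> -` U \<beta> \<gamma> n \<inter> K \<alpha>)"

definition B :: "omega1 \<Rightarrow> omega1 \<Rightarrow> omega1 \<Rightarrow> nat \<Rightarrow> ((omega1 \<Rightarrow> bool) set \<Rightarrow> real) set" where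
  "B \<theta> \<delta> \<alpha> n = {\<mu> \<in> radon_measures (space_at K \<alpha>). tv_norm (space_at K \<alpha>) \<mu> = 1 \<and>
     push_forward (space_at K \<alpha>) (space_at K \<theta>) (proj \<theta>) \<mu> = \<nu> \<theta> \<delta> n}"

end

text \<open>The parameters are total functions; only their values at ordinals in the stated ranges are
  constrained or used.\<close>

locale talagrand_realisation = talagrand_data +
  assumes compact_K: "omega \<le> \<alpha> \<Longrightarrow> compactin (cube {..<\<alpha>}) (K \<alpha>)"
    and K_omega: "K omega = topspace (cube {..<omega})"
    and closed_Y: "omega \<le> \<alpha> \<Longrightarrow> closedin (space_at K \<alpha>) (Y \<alpha>)"
    and closed_Z: "omega \<le> \<alpha> \<Longrightarrow> closedin (space_at K \<alpha>) (Z \<alpha>)"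
    and Y_Un_Z: "omega \<le> \<alpha> \<Longrightarrow> Y \<alpha> \<union> Z \<alpha> = K \<alpha>"
    and K_osuc: "omega \<le> \<alpha> \<Longrightarrow>
      K (osuc \<alpha>) = extend_by \<alpha> False (Y \<alpha>) \<union> extend_by \<alpha> True (Z \<alpha>)"
    and K_limit: "omega < \<rho> \<Longrightarrow> limit_ordinal \<rho> \<Longrightarrow> K \<rho> = inverse_limit K {..<\<rho>}"
    and eta_bounds: "omega \<le> \<alpha> \<Longrightarrow> \<eta> \<alpha> = (\<theta>, \<delta>) \<Longrightarrow> omega \<le> \<theta> \<and> \<theta> \<le> \<alpha> \<and> \<delta> \<le> \<alpha>"
    and eta_cofinal: "omega \<le> \<theta> \<Longrightarrow> \<exists>\<alpha>\<ge>\<xi>. max \<theta> \<delta> \<le> \<alpha> \<and> \<eta> \<alpha> = (\<theta>, \<delta>)"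
    and U_enum: "omega \<le> \<beta> \<Longrightarrow> range (U \<beta>) = disjoint_clopen_seqs (space_at K \<beta>)"
    and nu_enum: "omega \<le> \<theta> \<Longrightarrow> range (\<nu> \<theta>) = admissible_seqs (space_at K \<theta>) (V \<theta> \<theta>)"
    and J_subset_I: "omega \<le> \<theta> \<Longrightarrow> \<theta> < \<alpha> \<Longrightarrow> \<delta> < \<alpha> \<Longrightarrow> J \<theta> \<delta> \<alpha> \<subseteq> I \<theta> \<alpha>"
    and N_disjoint: "omega \<le> \<theta> \<Longrightarrow> N0 \<theta> \<delta> \<inter> N1 \<theta> \<delta> = {}"
    and J_N0_infinite: "omega \<le> \<theta> \<Longrightarrow> \<theta> < \<alpha> \<Longrightarrow> \<delta> < \<alpha> \<Longrightarrow> infinite (J \<theta> \<delta> \<alpha> \<inter> N0 \<theta> \<delta>)"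
    and J_N1_infinite: "omega \<le> \<theta> \<Longrightarrow> \<theta> < \<alpha> \<Longrightarrow> \<delta> < \<alpha> \<Longrightarrow> infinite (J \<theta> \<delta> \<alpha> \<inter> N1 \<theta> \<delta>)"
    and J_almost_decreasing: "omega \<le> \<theta> \<Longrightarrow> \<theta> < \<alpha>' \<Longrightarrow> \<alpha>' \<le> \<alpha> \<Longrightarrow> \<delta> < \<alpha>' \<Longrightarrow>
      finite (J \<theta> \<delta> \<alpha> - J \<theta> \<delta> \<alpha>')"
    and I_almost_decreasing: "omega \<le> \<theta> \<Longrightarrow> \<theta> < \<alpha>' \<Longrightarrow> \<alpha>' \<le> \<alpha> \<Longrightarrow> finite (I \<theta> \<alpha> - I \<theta> \<alpha>')"
    and I_determined: "omega \<le> \<theta> \<Longrightarrow> \<theta> \<le> \<alpha>' \<Longrightarrow> \<alpha>' < \<alpha> \<Longrightarrow>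
      \<exists>m. \<forall>n\<in>I \<theta> \<alpha>. n \<ge> m \<longrightarrow>
        (\<forall>t\<in>V \<theta> \<alpha> n. \<forall>t'\<in>V \<theta> \<alpha> n. proj \<theta> t = proj \<theta> t' \<longrightarrow> t \<alpha>' = t' \<alpha>')"
    and weak_star_limit: "omega \<le> \<theta> \<Longrightarrow> \<theta> < \<alpha> \<Longrightarrow> \<delta> < \<alpha> \<Longrightarrow> (\<forall>n. \<mu> n \<in> B \<theta> \<delta> \<alpha> n) \<Longrightarrow>
      \<exists>\<mu>'. weak_star_limit_along (space_at K \<alpha>) (J \<theta> \<delta> \<alpha>) \<mu> \<mu>'"
    and oscillation: "omega \<le> \<alpha>' \<Longrightarrow> \<eta> \<alpha>' = (\<theta>, \<delta>) \<Longrightarrow> (\<forall>n. \<mu> n \<in> B \<theta> \<delta> (osuc \<alpha>') n) \<Longrightarrow>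
      infinite {n. \<mu> n (extend_by \<alpha>' True (Z \<alpha>')) \<ge> 1/6} \<and>
      infinite {n. \<mu> n (extend_by \<alpha>' True (Z \<alpha>')) = 0}"

text \<open>The side conditions in \<^const>\<open>has_2DCP\<close> and \<^const>\<open>h_homogeneous\<close> always hold for
  subspaces of Cantor cubes.\<close>

lemma final_compactum_Tychonoff:
  "completely_regular_space (final_compactum K)" "Hausdorff_space (final_compactum K)"
  unfolding final_compactum_def cube_def
  by (auto intro!: completely_regular_space_subtopology Hausdorff_space_subtopology
      simp: completely_regular_space_product_topology Hausdorff_space_product_topology
        completely_regular_space_discrete_topology)

lemma final_compactum_dim_le_0: "final_compactum K dim_le 0"
proof -
  have "neighbourhood_base_of (\<lambda>W. closedin (cube A) W \<and> openin (cube A) W) (cube A)" for A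
    unfolding neighbourhood_base_of
  proof (intro allI impI, elim conjE)
    fix W x assume "openin (cube A) W" and "x \<in> W"
    then obtain F where F: "finite {i \<in> A. F i \<noteq> UNIV}" "x \<in> Pi\<^sub>E A F" "Pi\<^sub>E A F \<subseteq> W"
      unfolding cube_def openin_product_topology_alt by auto
    have "openin (cube A) (Pi\<^sub>E A F)" "closedin (cube A) (Pi\<^sub>E A F)"
      using F(1) unfolding cube_def
      by (auto simp: openin_PiE_gen closedin_product_topology)
    then show "\<exists>U V. openin (cube A) U \<and> (closedin (cube A) V \<and> openin (cube A) V) \<and>
        x \<in> U \<and> U \<subseteq> V \<and> V \<subseteq> W"
      using F by blast
  qed
  then show ?thesis
    unfolding final_compactum_def
    by (intro dimension_le_subtopology) (simp add: dimension_le_0_neighbourhood_base_of_clopen)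
qed

end

theory Submission
  imports Defs
begin

text \<open>Local homogeneity produces 2DCP by itself: an infinite compact locally homogeneous space has no
  isolated points, so a non-empty clopen set \<open>C\<close> contains two points, and a local
  homeomorphism between them restricts to one from a clopen set \<open>A \<subseteq> C\<close> onto a
  subset of \<open>C - A\<close>; iterating gives the required sequence. In an h-homogeneous space with two
  points the constant sequence works. It remains to see that \<open>T\<close> is compact and infinite: every
  \<open>t\<close> in \<open>2\<^sup>\<omega>\<close> extends to a point of \<open>T\<close> by choosing the coordinate \<open>\<alpha>\<close> to
  be \<open>1\<close> iff the restriction to \<open>\<alpha>\<close> lies in \<open>Z\<^sub>\<alpha>\<close>.\<close>

section \<open>Homogeneity and 2DCP\<close>

lemma dim_le_0_clopen_neighbourhood:
  assumes "X dim_le 0" "openin X W" "x \<in> W"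
  obtains A where "openin X A" "closedin X A" "x \<in> A" "A \<subseteq> W"
  using assms unfolding dimension_le_0_neighbourhood_base_of_clopen neighbourhood_base_of
  by (metis subsetD subset_trans)

text \<open>A local homeomorphism taking \<open>x\<close> to \<open>y\<close> is an open map between
  open subspaces, so it carries isolated points to isolated points.\<close>

lemma locally_homogeneous_openin_singleton:
  assumes "locally_homogeneous X" "openin X {x}" "y \<in> topspace X"
  shows "openin X {y}"
proof -
  have "x \<in> topspace X"
    using openin_subset[OF assms(2)] by simp
  then obtain U V \<phi> where *: "openin X U" "x \<in> U" "openin X V" "y \<in> V"
    "homeomorphic_map (subtopology X U) (subtopology X V) \<phi>" "\<phi> x = y"
    using assms(1,3) unfolding locally_homogeneous_def by meson
  have "openin (subtopology X U) {x}"
    using * assms(2) by (simp add: openin_open_subtopology)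
  then have "openin (subtopology X V) (\<phi> ` {x})"
    using homeomorphic_imp_open_map[OF *(5)] unfolding open_map_def by blast
  then show ?thesis
    using * by (simp add: openin_open_subtopology)
qed

text \<open>One isolated point would make every point isolated, and a compact discrete space is
  finite.\<close>

lemma locally_homogeneous_no_isolated_points:
  assumes "locally_homogeneous X" "compact_space X" "infinite (topspace X)"
  shows "\<not> openin X {x}"
proof
  assume "openin X {x}"
  then have "X = discrete_topology (topspace X)"
    using locally_homogeneous_openin_singleton[OF assms(1)]
    by (metis discrete_topology_unique)
  then show False
    using assms(2,3) by (metis compact_space_discrete_topology)
qed

text \<open>Separate two points of \<open>C\<close> by disjoint open sets and shrink the domain of a
  local homeomorphism between them until it and its image lie on opposite sides. The clopen
  \<open>A\<close> serves as the next set in the iteration; \<open>B\<close> is its image.\<close>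

lemma locally_homogeneous_clopen_two_copies:
  assumes "locally_homogeneous X" "Hausdorff_space X" "X dim_le 0"
    and no_isolated: "\<And>x. \<not> openin X {x}"
    and C: "openin X C" "C \<noteq> {}"
  obtains A B where "openin X A" "closedin X A" "A \<noteq> {}" "A \<subseteq> C" "B \<subseteq> C" "A \<inter> B = {}"
    "subtopology X B homeomorphic_space subtopology X A"
proof -
  obtain x where "x \<in> C"
    using C by blast
  moreover have "C \<noteq> {x}"
    using C(1) no_isolated by blast
  ultimately obtain y where xy: "x \<in> C" "y \<in> C" "x \<noteq> y"
    by blast
  have top: "x \<in> topspace X" "y \<in> topspace X"
    using xy openin_subset[OF C(1)] by auto
  obtain P Q where PQ: "openin X P" "openin X Q" "x \<in> P" "y \<in> Q" "disjnt P Q"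
    using \<open>Hausdorff_space X\<close> top \<open>x \<noteq> y\<close> unfolding Hausdorff_space_def by meson
  obtain U V \<phi> where UV: "openin X U" "x \<in> U" "openin X V" "y \<in> V"
    and \<phi>: "homeomorphic_map (subtopology X U) (subtopology X V) \<phi>" "\<phi> x = y"
    using assms(1) top unfolding locally_homogeneous_def by meson
  \<comment> \<open>\<open>W\<close> keeps the image inside \<open>C\<close> and inside
    \<open>Q\<close>; intersecting with \<open>P\<close> will then make the image disjoint from its
    source.\<close>
  define W where "W = {z \<in> U. \<phi> z \<in> V \<inter> (Q \<inter> C)}"
  have "openin (subtopology X V) (V \<inter> (Q \<inter> C))"
    using UV PQ C by (simp add: openin_open_subtopology openin_Int)
  then have "openin (subtopology X U) {z \<in> topspace (subtopology X U). \<phi> z \<in> V \<inter> (Q \<inter> C)}"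
    by (rule openin_continuous_map_preimage[OF homeomorphic_imp_continuous_map[OF \<phi>(1)]])
  moreover have "topspace (subtopology X U) = U"
    using openin_subset[OF UV(1)] by auto
  ultimately have "openin X W"
    using UV(1) unfolding W_def by (simp only: openin_open_subtopology)
  then have "openin X (W \<inter> (P \<inter> C))"
    using PQ C by (simp add: openin_Int)
  moreover have "x \<in> W \<inter> (P \<inter> C)"
    using xy PQ UV \<phi>(2) unfolding W_def by simp
  ultimately obtain A where A: "openin X A" "closedin X A" "x \<in> A" "A \<subseteq> W \<inter> (P \<inter> C)"
    using dim_le_0_clopen_neighbourhood[OF \<open>X dim_le 0\<close>] by metis
  have AU: "A \<subseteq> U" and BV: "\<phi> ` A \<subseteq> V \<inter> (Q \<inter> C)"
    using A(4) unfolding W_def by auto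
  have "homeomorphic_map (subtopology (subtopology X U) A) (subtopology (subtopology X V) (\<phi> ` A)) \<phi>"
  proof (rule homeomorphic_map_subtopologies_alt[OF \<phi>(1)])
    \<comment> \<open>By injectivity of \<open>\<phi>\<close> on \<open>U\<close>, the set
      \<open>A\<close> is the full preimage of its image.\<close>
    show "\<phi> z \<in> \<phi> ` A \<longleftrightarrow> z \<in> A"
      if "z \<in> topspace (subtopology X U)" "\<phi> z \<in> topspace (subtopology X V)" for z
      using that AU homeomorphic_imp_injective_map[OF \<phi>(1)] openin_subset[OF UV(1)]
      by (auto simp: inj_on_def)
  qed
  then have "homeomorphic_map (subtopology X A) (subtopology X (\<phi> ` A)) \<phi>"
    using AU BV by (simp add: subtopology_subtopology Int_absorb1)
  then have "subtopology X (\<phi> ` A) homeomorphic_space subtopology X A"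
    using homeomorphic_map_imp_homeomorphic_space homeomorphic_space_sym by blast
  moreover have "A \<inter> \<phi> ` A = {}"
    using A(4) BV PQ(5) unfolding disjnt_def by blast
  ultimately show thesis
    using that[of A "\<phi> ` A"] A BV by blast
qed

proposition locally_homogeneous_imp_has_2DCP:
  assumes "locally_homogeneous X" "compact_space X" "Hausdorff_space X" "X dim_le 0"
    and "infinite (topspace X)"
  shows "has_2DCP X"
proof -
  let ?P = "\<lambda>C. openin X C \<and> closedin X C \<and> C \<noteq> {}"
  let ?Q = "\<lambda>C D. \<exists>B. D \<subseteq> C \<and> B \<subseteq> C \<and> D \<inter> B = {} \<and>
    subtopology X B homeomorphic_space subtopology X D"
  \<comment> \<open>One of the two copies of \<open>L (Suc n)\<close> in \<open>L n\<close> is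
    \<open>L (Suc n)\<close> itself, so each step only has to find the other copy
    \<open>B\<close>.\<close>
  have "\<exists>L :: nat \<Rightarrow> 'a set. \<forall>n. ?P (L n) \<and> ?Q (L n) (L (Suc n))"
  proof (rule dependent_nat_choice)
    show "\<exists>C. ?P C"
      using assms(5) by (metis closedin_topspace openin_topspace finite.emptyI)
    show "\<exists>D. ?P D \<and> ?Q C D" if "?P C" for C and n :: nat
      using locally_homogeneous_clopen_two_copies[OF assms(1,3,4)
          locally_homogeneous_no_isolated_points[OF assms(1,2,5)], of C] that
      by metis
  qed
  then obtain L :: "nat \<Rightarrow> 'a set" where L: "\<And>n. ?P (L n)" "\<And>n. ?Q (L n) (L (Suc n))"
    by blast
  have "completely_regular_space X"
    using assms(2,3) compact_Hausdorff_or_regular_imp_normal_space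
      normal_imp_completely_regular_space_gen by blast
  moreover have "L n \<noteq> {} \<and> compactin X (L n) \<and> (\<exists>A B. A \<subseteq> L n \<and> B \<subseteq> L n \<and> A \<inter> B = {} \<and>
      subtopology X A homeomorphic_space subtopology X (L (Suc n)) \<and>
      subtopology X B homeomorphic_space subtopology X (L (Suc n)))" for n
    using L[of n] assms(2) closedin_compact_space homeomorphic_space_refl by metis
  ultimately show ?thesis
    using assms(3) unfolding has_2DCP_def by blast
qed

text \<open>A clopen set separating \<open>x\<close> from \<open>y\<close> and its complement are
  both copies of the whole space.\<close>

proposition h_homogeneous_imp_has_2DCP:
  assumes "h_homogeneous X" "compact_space X" "Hausdorff_space X"
    and xy: "x \<in> topspace X" "y \<in> topspace X" "x \<noteq> y"
  shows "has_2DCP X"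
proof -
  have dim: "X dim_le 0" and hom: "\<And>C. openin X C \<Longrightarrow> closedin X C \<Longrightarrow> C \<noteq> {} \<Longrightarrow>
      subtopology X C homeomorphic_space X"
    using assms(1) unfolding h_homogeneous_def by auto
  have "openin X (topspace X - {y})"
    using closedin_Hausdorff_singleton[OF assms(3) xy(2)] by blast
  then obtain C where C: "openin X C" "closedin X C" "x \<in> C" "C \<subseteq> topspace X - {y}"
    using dim_le_0_clopen_neighbourhood[OF dim, of "topspace X - {y}" x] xy by blast
  have "subtopology X C homeomorphic_space X"
    using C by (intro hom) auto
  moreover have "subtopology X (topspace X - C) homeomorphic_space X"
    using C xy by (intro hom) auto
  moreover have "completely_regular_space X"
    using assms(2,3) compact_Hausdorff_or_regular_imp_normal_space
      normal_imp_completely_regular_space_gen by blast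
  ultimately show ?thesis
    using assms(2,3) C xy unfolding has_2DCP_def compact_space_def
    by (intro conjI exI[of _ "\<lambda>_. topspace X"] allI exI[of _ C] exI[of _ "topspace X - C"]) auto
qed

section \<open>Successors and limits\<close>

text \<open>Regularity of \<omega>1: \<open>A\<close> together with the initial segments below its
  members is countable, and any ordinal outside that union is a strict bound.\<close>

lemma omega1_bounded_countable:
  assumes "countable (A :: omega1 set)"
  obtains \<beta> where "\<And>\<alpha>. \<alpha> \<in> A \<Longrightarrow> \<alpha> < \<beta>"
proof -
  have "countable (\<Union>\<alpha>\<in>A. {..<\<alpha>})"
    using assms countable_lessThan_omega1 by (intro countable_UN) auto
  then have "countable (A \<union> (\<Union>\<alpha>\<in>A. {..<\<alpha>}))"
    using assms by simp
  then obtain \<beta> where "\<beta> \<notin> A \<union> (\<Union>\<alpha>\<in>A. {..<\<alpha>})"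
    using uncountable_UNIV_omega1 by (metis UNIV_eq_I)
  then show thesis
    by (intro that[of \<beta>]) (force simp: not_less le_less)
qed

text \<open>There is no largest countable ordinal, so the \<open>LEAST\<close> defining
  \<open>osuc\<close> is attained.\<close>

lemma less_osuc: "\<alpha> < osuc \<alpha>"
proof -
  obtain \<beta> where "\<alpha> < \<beta>"
    using omega1_bounded_countable[of "{\<alpha>}"] by auto
  then show ?thesis
    unfolding osuc_def by (rule LeastI)
qed

lemma osuc_le_iff: "osuc \<alpha> \<le> \<beta> \<longleftrightarrow> \<alpha> < \<beta>"
proof
  show "osuc \<alpha> \<le> \<beta> \<Longrightarrow> \<alpha> < \<beta>"
    by (rule less_le_trans[OF less_osuc])
  show "\<alpha> < \<beta> \<Longrightarrow> osuc \<alpha> \<le> \<beta>"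
    unfolding osuc_def by (rule Least_le)
qed

lemma less_osuc_iff: "\<beta> < osuc \<alpha> \<longleftrightarrow> \<beta> \<le> \<alpha>"
  using osuc_le_iff[of \<alpha> \<beta>] by (simp add: not_le[symmetric])

lemma limit_ordinal_omega: "limit_ordinal omega"
proof -
  \<comment> \<open>The starting ordinal is arbitrary: since \<open>omega\<close> is a least limit
    ordinal, it is enough that some limit ordinal exists, and the supremum of iterated successors is
    one.\<close>
  define s where "s n = (osuc ^^ n) undefined" for n :: nat
  obtain \<beta> where "\<And>\<alpha>. \<alpha> \<in> range s \<Longrightarrow> \<alpha> < \<beta>"
    using omega1_bounded_countable[of "range s"] by auto
  then have ex: "\<forall>n. s n < \<beta>"
    by blast
  define \<rho> where "\<rho> = (LEAST \<rho>. \<forall>n. s n < \<rho>)"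
  have \<rho>: "s n < \<rho>" for n
    using LeastI[of "\<lambda>\<rho>. \<forall>n. s n < \<rho>", OF ex] unfolding \<rho>_def by blast
  have "osuc \<beta> < \<rho>" if "\<beta> < \<rho>" for \<beta>
  proof -
    \<comment> \<open>Minimality of \<open>\<rho>\<close>: nothing smaller strictly bounds the
      sequence.\<close>
    have "\<not> (\<forall>n. s n < \<beta>)"
      using not_less_Least[of \<beta> "\<lambda>\<rho>. \<forall>n. s n < \<rho>"] that unfolding \<rho>_def by blast
    then obtain n where "\<beta> \<le> s n"
      by (auto simp: not_less)
    then have "\<beta> < s (Suc n)"
      by (simp add: s_def less_osuc_iff)
    then have "osuc \<beta> \<le> s (Suc n)"
      by (simp add: osuc_le_iff)
    then show ?thesis
      using \<rho> by (rule le_less_trans)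
  qed
  then have "limit_ordinal \<rho>"
    using \<rho> unfolding limit_ordinal_def by blast
  then show ?thesis
    unfolding omega_def by (rule LeastI)
qed

text \<open>A finite segment would have a maximum, whose successor still lies below the limit
  \<open>omega\<close>.\<close>

lemma infinite_lessThan_omega: "infinite {..<omega}"
proof
  assume fin: "finite {..<omega}"
  have "Max {..<omega} \<in> {..<omega}"
    using fin limit_ordinal_omega unfolding limit_ordinal_def by (intro Max_in) auto
  then have "osuc (Max {..<omega}) \<in> {..<omega}"
    using limit_ordinal_omega unfolding limit_ordinal_def by simp
  then have "osuc (Max {..<omega}) \<le> Max {..<omega}"
    using fin by (rule Max_ge[rotated])
  then show False
    using less_osuc leD by blast
qed

lemma above_omega_cases:
  assumes "omega < \<alpha>"
  obtains (limit) "limit_ordinal \<alpha>" | (osuc) \<beta> where "omega \<le> \<beta>" "\<alpha> = osuc \<beta>"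
proof (cases "limit_ordinal \<alpha>")
  case False
  then obtain \<beta> where "\<beta> < \<alpha>" "\<alpha> \<le> osuc \<beta>"
    using assms unfolding limit_ordinal_def by (auto simp: not_less)
  then have "\<alpha> = osuc \<beta>"
    by (simp add: osuc_le_iff antisym)
  moreover have "omega \<le> \<beta>"
    using assms by (simp add: \<open>\<alpha> = osuc \<beta>\<close> less_osuc_iff)
  ultimately show thesis
    by (rule osuc[rotated])
qed (rule limit)

section \<open>The final compactum\<close>

lemma proj_in_topspace_cube: "proj \<beta> t \<in> topspace (cube {..<\<beta>})"
  by (simp add: cube_def proj_def)

lemma proj_proj: "\<beta> \<le> \<alpha> \<Longrightarrow> proj \<beta> (proj \<alpha> t) = proj \<beta> t"
  by (auto simp: proj_def restrict_def fun_eq_iff)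

lemma proj_osuc: "proj (osuc \<beta>) t = (proj \<beta> t)(\<beta> := t \<beta>)"
  by (auto simp: proj_def restrict_def fun_eq_iff less_osuc_iff)

lemma continuous_map_proj: "continuous_map (cube UNIV) (cube {..<\<beta>}) (proj \<beta>)"
  unfolding cube_def proj_def continuous_map_componentwise
  by (auto intro: continuous_map_product_projection)

lemma Hausdorff_space_cube: "Hausdorff_space (cube A)"
  by (simp add: cube_def Hausdorff_space_product_topology)

lemma compact_space_cube: "compact_space (cube A)"
  by (simp add: cube_def compact_space_product_topology compact_space_discrete_topology)

context talagrand_realisation
begin

text \<open>Every function is a point of \<open>cube UNIV\<close>, so only the restrictions impose
  conditions.\<close>

lemma topspace_final_compactum:
  "topspace (final_compactum K) = {t. \<forall>\<beta>\<ge>omega. proj \<beta> t \<in> K \<beta>}"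
  by (auto simp: final_compactum_def inverse_limit_def cube_def)

text \<open>The inverse limit is an intersection of preimages of the closed sets
  \<open>K \<beta>\<close> under continuous restrictions, hence closed in a compact cube.\<close>

lemma compact_space_final_compactum: "compact_space (final_compactum K)"
proof -
  have "closedin (cube UNIV) (\<Inter>\<beta>\<in>{omega..}. {t \<in> topspace (cube UNIV). proj \<beta> t \<in> K \<beta>})"
  proof (intro closedin_INT)
    show "closedin (cube UNIV) {t \<in> topspace (cube UNIV). proj \<beta> t \<in> K \<beta>}"
      if "\<beta> \<in> {omega..}" for \<beta>
      using that
      by (intro closedin_continuous_map_preimage[OF continuous_map_proj]
          compactin_imp_closedin[OF Hausdorff_space_cube compact_K]) simp
  qed auto
  moreover have "(\<Inter>\<beta>\<in>{omega..}. {t \<in> topspace (cube UNIV). proj \<beta> t \<in> K \<beta>}) = inverse_limit K UNIV"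
    by (auto simp: inverse_limit_def)
  ultimately show ?thesis
    unfolding final_compactum_def
    by (simp add: compact_space_subtopology closedin_compact_space compact_space_cube)
qed

text \<open>The new coordinates are defined by well-founded recursion, and an induction over stages
  shows that no restriction leaves \<open>K\<close>.\<close>

lemma final_compactum_extend:
  assumes "t \<in> K omega"
  obtains f where "f \<in> topspace (final_compactum K)" "proj omega f = t"
proof -
  define f where "f = wfrec {(\<alpha>, \<beta>). \<alpha> < \<beta>}
    (\<lambda>f \<alpha>. if \<alpha> < omega then t \<alpha> else proj \<alpha> f \<in> Z \<alpha>)"
  have f: "f \<alpha> = (if \<alpha> < omega then t \<alpha> else proj \<alpha> f \<in> Z \<alpha>)" for \<alpha>
  proof -
    \<comment> \<open>Cutting \<open>f\<close> off at \<open>\<alpha>\<close> is harmless because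
      \<open>proj \<alpha>\<close> reads only earlier coordinates.\<close>
    have "proj \<alpha> (cut f {(\<alpha>, \<beta>). \<alpha> < \<beta>} \<alpha>) = proj \<alpha> f"
      by (auto simp: proj_def cut_def restrict_def fun_eq_iff)
    then show ?thesis
      unfolding f_def by (subst wfrec[OF wf]) simp
  qed
  have proj_omega: "proj omega f = t"
  proof -
    \<comment> \<open>Equality of functions also concerns arguments from \<open>omega\<close> on,
      where both sides are \<open>undefined\<close>.\<close>
    have "t \<in> extensional {..<omega}"
      using assms by (simp add: K_omega cube_def PiE_def)
    then show ?thesis
      by (auto simp: proj_def f restrict_def extensional_def fun_eq_iff)
  qed
  have "omega \<le> \<alpha> \<Longrightarrow> proj \<alpha> f \<in> K \<alpha>" for \<alpha>
  proof (induction \<alpha> rule: less_induct)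
    case (less \<alpha>)
    show ?case
    proof (cases "\<alpha> = omega")
      case True
      then show ?thesis
        using assms proj_omega by simp
    next
      case False
      with less.prems have "omega < \<alpha>"
        by simp
      then show ?thesis
      proof (cases rule: above_omega_cases)
        case limit
        have "proj \<beta> (proj \<alpha> f) \<in> K \<beta>" if "\<beta> < \<alpha>" "omega \<le> \<beta>" for \<beta>
          using that less.IH by (simp add: proj_proj)
        then show ?thesis
          using K_limit[OF \<open>omega < \<alpha>\<close> limit] by (simp add: inverse_limit_def proj_in_topspace_cube)
      next
        case (osuc \<beta>)
        \<comment> \<open>The chosen digit is legal: it is \<open>True\<close> exactly on
          \<open>Z \<beta>\<close>, and a point of \<open>K \<beta>\<close> outside
          \<open>Z \<beta>\<close> lies in \<open>Y \<beta>\<close>.\<close>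
        have "proj \<beta> f \<in> Y \<beta> \<union> Z \<beta>"
          using less.IH[of \<beta>] osuc by (simp add: less_osuc Y_Un_Z)
        moreover have "f \<beta> \<longleftrightarrow> proj \<beta> f \<in> Z \<beta>"
          using f[of \<beta>] leD[OF osuc(1)] by simp
        ultimately show ?thesis
          unfolding osuc(2) K_osuc[OF osuc(1)] extend_by_def proj_osuc
          by (cases "f \<beta>") (simp_all del: fun_upd_apply)
      qed
    qed
  qed
  then show thesis
    using proj_omega by (intro that[of f]) (simp_all add: topspace_final_compactum)
qed

text \<open>Restriction to \<open>omega\<close> covers the infinite set
  \<open>K omega\<close>.\<close>

lemma infinite_topspace_final_compactum: "infinite (topspace (final_compactum K))"
proof
  assume "finite (topspace (final_compactum K))"
  then have "finite (proj omega ` topspace (final_compactum K))"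
    by simp
  then have "finite (K omega)"
    by (rule finite_subset[rotated]) (metis final_compactum_extend image_eqI subsetI)
  \<comment> \<open>The indicators of single coordinates are infinitely many points of the Cantor
    set.\<close>
  moreover have "(\<lambda>\<alpha>. \<lambda>\<beta>\<in>{..<omega}. \<beta> = \<alpha>) ` {..<omega} \<subseteq> K omega"
    by (auto simp: K_omega cube_def)
  moreover have "inj_on (\<lambda>\<alpha>. \<lambda>\<beta>\<in>{..<omega}. \<beta> = \<alpha>) {..<omega}"
  proof (rule inj_onI)
    fix \<alpha> \<beta>
    assume \<alpha>: "\<alpha> \<in> {..<omega}"
      and eq: "(\<lambda>\<gamma>\<in>{..<omega}. \<gamma> = \<alpha>) = (\<lambda>\<gamma>\<in>{..<omega}. \<gamma> = \<beta>)"
    show "\<alpha> = \<beta>"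
      using fun_cong[OF eq, of \<alpha>] \<alpha> by simp
  qed
  ultimately show False
    using infinite_lessThan_omega by (meson inj_on_finite)
qed

end

theorem corollary1p1:
  fixes S :: "omega1 set"
  assumes "stationary S" and "stationary (- S)" and "diamond S"
    and "talagrand_realisation K Y Z \<eta> U \<nu> I J N0 N1"
    and T_def: "T = final_compactum K"
    and no_disjoint_copies: "\<And>E F. closedin T E \<Longrightarrow> closedin T F \<Longrightarrow> E \<inter> F = {} \<Longrightarrow>
      \<not> metrizable_space (subtopology T E) \<Longrightarrow> \<not> metrizable_space (subtopology T F) \<Longrightarrow>
      \<not> subtopology T E homeomorphic_space subtopology T F"
    and "\<not> has_2DCP T"
  shows "\<not> locally_homogeneous T \<and> \<not> h_homogeneous T"
proof -
  interpret talagrand_realisation K Y Z \<eta> U \<nu> I J N0 N1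
    by fact
  have T: "compact_space T" "Hausdorff_space T" "T dim_le 0" "infinite (topspace T)"
    unfolding T_def
    by (simp_all only: compact_space_final_compactum final_compactum_Tychonoff
        final_compactum_dim_le_0 infinite_topspace_final_compactum not_False_eq_True)
  \<comment> \<open>The h-homogeneous case needs two distinct points, which the infinite space
    \<open>T\<close> supplies.\<close>
  obtain x where x: "x \<in> topspace T"
    using T(4) by (metis finite.emptyI ex_in_conv)
  have "infinite (topspace T - {x})"
    using T(4) by simp
  then obtain y where y: "y \<in> topspace T" "x \<noteq> y"
    by (metis DiffE finite.emptyI ex_in_conv insertI1)
  show ?thesis
    using \<open>\<not> has_2DCP T\<close> locally_homogeneous_imp_has_2DCP[OF _ T]
      h_homogeneous_imp_has_2DCP[OF _ T(1,2) x y] by blast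
qed

end
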